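(* Let $(Z,\preceq)$ be a preordered set, and $\phi:Z\to\overline{\mathbb{R}}$ a $\preceq$-increasing function. For $A_1,A_2\in 2^Z$ set $$A_1\preceq^{l}A_2 :\iff [\forall z_2\in A_2,\ \exists z_1\in A_1:\ z_1\preceq z_2],$$ $$A_1\preceq^{l}_{\phi}A_2 :\iff \big[A_1=A_2 \text{ or } [A_1\preceq^{l}A_2 \text{ and } \inf\phi(A_1)<\inf\phi(A_2)]\big].$$ Then $\preceq^{l}_{\phi}$ is a partial order on $2^Z$. Furthermore, let $\mathcal{A}\subset 2^Z$ be a nonempty set such that every $\preceq^{l}$-decreasing sequence $(A_n)_{n\ge1}\subset\mathcal{A}$ has a lower bound in $\mathcal{A}$, i.e. there is $B\in\mathcal{A}$ with $B\preceq^{l}A_n$ for all $n\ge1$. Then for every $A\in\mathcal{A}$ there exists $\overline{A}\in\mathcal{A}$ which is minimal in $\mathcal{A}$ with respect to $\preceq^{l}_{\phi}$ and satisfies $\overline{A}\preceq^{l}_{\phi}A$; moreover, for every $A'\in\mathcal{A}$, $A'\preceq^{l}\overline{A}$ implies $\inf\phi(A')=\inf\phi(\overline{A})$.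
   Context: $\overline{\mathbb{R}}=\mathbb{R}\cup\{\pm\infty\}$; $2^Z$ is the power set of $Z$ (including $\emptyset$); $\inf\emptyset=+\infty$. A function $\phi$ is $\preceq$-increasing if $z_1\preceq z_2$ implies $\phi(z_1)\le\phi(z_2)$. A sequence $(A_n)$ is $\preceq^{l}$-decreasing if $A_{n+1}\preceq^{l}A_n$ for all $n\ge 1$. The element $\overline{A}\in\mathcal{A}$ is minimal in $\mathcal{A}$ with respect to $\preceq^{l}_{\phi}$ if $A'\in\mathcal{A}$, $A'\preceq^{l}_{\phi}\overline{A}$ imply $A'=\overline{A}$. The relation $\preceq^{l}$ is a preorder on $2^Z$. *)

theory Defs
  imports Complex_Main "HOL-Library.Extended_Real"
begin

text \<open>
  A preordered set is given by a carrier \<open>Z\<close> and a relation \<open>r\<close> with \<^term>\<open>preorder_on Z r\<close>,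
  where \<open>(x, y) \<in> r\<close> stands for \<open>x \<preceq> y\<close>. The carrier may be empty. The subsets under
  consideration are the elements of \<^term>\<open>Pow Z\<close>, and the empty set is one of them.
\<close>

definition lower_le :: "('a \<times> 'a) set \<Rightarrow> 'a set \<Rightarrow> 'a set \<Rightarrow> bool" where
  "lower_le r A1 A2 \<longleftrightarrow> (\<forall>z2\<in>A2. \<exists>z1\<in>A1. (z1, z2) \<in> r)"

text \<open>
  In \<^typ>\<open>ereal\<close> the infimum of the empty set is the top element \<^term>\<open>\<infinity> :: ereal\<close>, as required.
\<close>

definition lower_le_phi ::
  "('a \<times> 'a) set \<Rightarrow> ('a \<Rightarrow> ereal) \<Rightarrow> 'a set \<Rightarrow> 'a set \<Rightarrow> bool" where
  "lower_le_phi r \<phi> A1 A2 \<longleftrightarrow>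
     A1 = A2 \<or> (lower_le r A1 A2 \<and> Inf (\<phi> ` A1) < Inf (\<phi> ` A2))"

text \<open>Sequences are indexed from 1; the value at index 0 is irrelevant.\<close>

definition lower_decreasing :: "('a \<times> 'a) set \<Rightarrow> (nat \<Rightarrow> 'a set) \<Rightarrow> bool" where
  "lower_decreasing r A \<longleftrightarrow> (\<forall>n\<ge>1. lower_le r (A (Suc n)) (A n))"

definition minimal_in :: "('b \<Rightarrow> 'b \<Rightarrow> bool) \<Rightarrow> 'b set \<Rightarrow> 'b \<Rightarrow> bool" where
  "minimal_in le S m \<longleftrightarrow> m \<in> S \<and> (\<forall>x\<in>S. le x m \<longrightarrow> x = m)"

end

(* This is the Brezis-Browder ordering principle, applied to the function sending a set A to the
   infimum of phi over A. Descend from a given point along an enumeration of the rationals, passing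
   at step n below the n-th rational whenever some smaller element allows it. If the function still
   decreased strictly below a lower bound of this sequence, a rational separating the two values
   would have been crossed already. *)
theory Submission
  imports Defs
begin

lemma brezis_browder:
  fixes g :: "'b \<Rightarrow> ereal"
  assumes trans: "\<And>x y z. x \<in> X \<Longrightarrow> y \<in> X \<Longrightarrow> z \<in> X \<Longrightarrow> le x y \<Longrightarrow> le y z \<Longrightarrow> le x z"
    and refl: "\<And>x. x \<in> X \<Longrightarrow> le x x"
    and mono: "\<And>x y. x \<in> X \<Longrightarrow> y \<in> X \<Longrightarrow> le x y \<Longrightarrow> g x \<le> g y"
    and bound: "\<And>s :: nat \<Rightarrow> 'b. (\<And>n. s n \<in> X) \<Longrightarrow> (\<And>n. le (s (Suc n)) (s n)) \<Longrightarrow>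
      \<exists>b\<in>X. \<forall>n. le b (s n)"
    and a: "a \<in> X"
  shows "\<exists>b\<in>X. le b a \<and> (\<forall>y\<in>X. le y b \<longrightarrow> g y = g b)"
proof -
  \<comment> \<open>Countably many thresholds suffice even where \<open>g\<close> is infinite, since
    a rational lies strictly between any two distinct extended reals.\<close>
  define q :: "nat \<Rightarrow> ereal" where "q n = ereal (of_rat (from_nat n))" for n
  define step where "step n x y \<longleftrightarrow>
    le y x \<and> ((\<exists>z\<in>X. le z x \<and> g z < q n) \<longrightarrow> g y < q n)" for n x y
  \<comment> \<open>If no element of \<open>X\<close> below \<open>x\<close> gets under the
    threshold, the sequence stays at \<open>x\<close>, by reflexivity.\<close>
  have ex_step: "\<exists>y. y \<in> X \<and> step n x y" if "x \<in> X" for n x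
    using that refl unfolding step_def by blast
  \<comment> \<open>The clause for \<open>n = 0\<close> carries the starting point \<open>a\<close>
    through dependent choice.\<close>
  have "\<exists>s. \<forall>n. (s n \<in> X \<and> (n = 0 \<longrightarrow> s n = a)) \<and> step n (s n) (s (Suc n))"
    by (rule dependent_nat_choice) (use a ex_step in auto)
  then obtain s where sX: "s n \<in> X" and s0: "s 0 = a" and s_step: "step n (s n) (s (Suc n))" for n
    by blast
  obtain b where bX: "b \<in> X" and b: "\<And>n. le b (s n)"
    using bound[of s] sX s_step unfolding step_def by blast
  have "g y = g b" if y: "y \<in> X" "le y b" for y
  proof (rule ccontr)
    assume "g y \<noteq> g b"
    with mono[OF y(1) bX y(2)] have "g y < g b" by simp
    then obtain p :: rat where "g y < ereal (of_rat p)" "ereal (of_rat p) < g b"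
      using ereal_dense3 by blast
    then obtain n where n: "g y < q n" "q n < g b"
      unfolding q_def by (metis from_nat_to_nat)
    \<comment> \<open>So \<open>y\<close> itself shows that \<open>q n\<close> could be crossed from
      \<open>s n\<close>; hence step \<open>n\<close> crossed it, and \<open>b\<close> lies below
      the result.\<close>
    have "le y (s n)"
      using trans[OF y(1) bX sX y(2) b] .
    then have "g (s (Suc n)) < q n"
      using s_step[of n] y(1) n(1) unfolding step_def by blast
    moreover have "g b \<le> g (s (Suc n))"
      using mono[OF bX sX b] .
    ultimately show False
      using n(2) by simp
  qed
  then show ?thesis
    using bX b[of 0] s0 by auto
qed

lemma lower_le_refl:
  assumes "preorder_on Z r" "A \<subseteq> Z"
  shows "lower_le r A A"
  using assms unfolding lower_le_def preorder_on_def refl_on_def by blast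

lemma lower_le_trans:
  assumes "trans r" "lower_le r A B" "lower_le r B C"
  shows "lower_le r A C"
  using assms unfolding lower_le_def by (meson transD)

lemma lower_le_Inf_mono:
  fixes \<phi> :: "'a \<Rightarrow> 'b :: complete_lattice"
  assumes "monotone_on Z (\<lambda>x y. (x, y) \<in> r) (\<le>) \<phi>" "A \<subseteq> Z" "B \<subseteq> Z" "lower_le r A B"
  shows "Inf (\<phi> ` A) \<le> Inf (\<phi> ` B)"
proof (rule INF_mono)
  fix z assume "z \<in> B"
  with assms(4) obtain w where "w \<in> A" "(w, z) \<in> r"
    unfolding lower_le_def by blast
  with \<open>z \<in> B\<close> assms(1-3) show "\<exists>w\<in>A. \<phi> w \<le> \<phi> z"
    unfolding monotone_on_def by blast
qed

text \<open>Antisymmetry comes from the strict inequality: two distinct sets related both ways would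
  each have the smaller infimum.\<close>

lemma partial_order_on_lower_le_phi:
  assumes "trans r"
  shows "partial_order_on X {(A, B). A \<in> X \<and> B \<in> X \<and> lower_le_phi r \<phi> A B}"
proof -
  have "lower_le_phi r \<phi> A C" if "lower_le_phi r \<phi> A B" "lower_le_phi r \<phi> B C" for A B C
    using that lower_le_trans[OF assms] less_trans unfolding lower_le_phi_def by blast
  then show ?thesis
    unfolding partial_order_on_def preorder_on_def refl_on_def trans_def antisym_def
    by (auto simp: lower_le_phi_def)
qed

theorem corollary3p14:
  fixes Z :: "'a set" and r :: "('a \<times> 'a) set" and \<phi> :: "'a \<Rightarrow> ereal"
  assumes "preorder_on Z r"
    and "monotone_on Z (\<lambda>x y. (x, y) \<in> r) (\<le>) \<phi>"
  shows "partial_order_on (Pow Z)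
           {(A1, A2). A1 \<in> Pow Z \<and> A2 \<in> Pow Z \<and> lower_le_phi r \<phi> A1 A2} \<and>
         (\<forall>\<A>. \<A> \<subseteq> Pow Z \<longrightarrow> \<A> \<noteq> {} \<longrightarrow>
           (\<forall>S. (\<forall>n\<ge>1. S n \<in> \<A>) \<and> lower_decreasing r S \<longrightarrow>
             (\<exists>B\<in>\<A>. \<forall>n\<ge>1. lower_le r B (S n))) \<longrightarrow>
           (\<forall>A\<in>\<A>. \<exists>Abar\<in>\<A>.
             minimal_in (lower_le_phi r \<phi>) \<A> Abar \<and>
             lower_le_phi r \<phi> Abar A \<and>
             (\<forall>A'\<in>\<A>. lower_le r A' Abar \<longrightarrow> Inf (\<phi> ` A') = Inf (\<phi> ` Abar))))"
proof (intro conjI allI impI ballI)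
  have tr: "trans r"
    using assms(1) unfolding preorder_on_def by blast
  show "partial_order_on (Pow Z)
      {(A1, A2). A1 \<in> Pow Z \<and> A2 \<in> Pow Z \<and> lower_le_phi r \<phi> A1 A2}"
    using tr by (rule partial_order_on_lower_le_phi)
  fix \<A> A
  assume sub: "\<A> \<subseteq> Pow Z" and A: "A \<in> \<A>"
    and bdd: "\<forall>S. (\<forall>n\<ge>1. S n \<in> \<A>) \<and> lower_decreasing r S \<longrightarrow>
      (\<exists>B\<in>\<A>. \<forall>n\<ge>1. lower_le r B (S n))"
  let ?g = "\<lambda>A. Inf (\<phi> ` A)"
  have mono: "?g B \<le> ?g C" if "B \<in> \<A>" "C \<in> \<A>" "lower_le r B C" for B C
    using lower_le_Inf_mono[OF assms(2) _ _ that(3)] that(1,2) sub by blast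
  have bound: "\<exists>B\<in>\<A>. \<forall>n. lower_le r B (S n)"
    if S: "\<And>n. S n \<in> \<A>" "\<And>n. lower_le r (S (Suc n)) (S n)" for S :: "nat \<Rightarrow> 'a set"
  proof -
    obtain B where "B \<in> \<A>" and B: "\<And>n. n \<ge> 1 \<Longrightarrow> lower_le r B (S n)"
      using bdd S unfolding lower_decreasing_def by blast
    \<comment> \<open>Going through \<open>S (Suc n)\<close> also covers index 0, about which
      \<open>B\<close> says nothing directly.\<close>
    have "lower_le r B (S n)" for n
      using lower_le_trans[OF tr B[of "Suc n"] S(2)] by simp
    with \<open>B \<in> \<A>\<close> show ?thesis by blast
  qed
  \<comment> \<open>The descent uses the preorder \<open>lower_le\<close>, because the hypothesis on
    sequences concerns that relation.\<close>
  have ex: "\<exists>B\<in>\<A>. lower_le r B C \<and> (\<forall>A'\<in>\<A>. lower_le r A' B \<longrightarrow> ?g A' = ?g B)"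
    if "C \<in> \<A>" for C
  proof (rule brezis_browder)
    show "lower_le r x z" if "lower_le r x y" "lower_le r y z" for x y z
      using lower_le_trans[OF tr that] .
    show "lower_le r x x" if "x \<in> \<A>" for x
      using lower_le_refl[OF assms(1)] that sub by blast
  qed (fact mono bound that)+
  have "\<exists>B\<in>\<A>. lower_le_phi r \<phi> B A \<and> (\<forall>A'\<in>\<A>. lower_le r A' B \<longrightarrow> ?g A' = ?g B)"
  proof (cases "\<forall>A'\<in>\<A>. lower_le r A' A \<longrightarrow> ?g A' = ?g A")
    \<comment> \<open>Here \<open>A\<close> itself serves, through the equality disjunct.\<close>
    case True
    with A show ?thesis
      unfolding lower_le_phi_def by blast
  next
    \<comment> \<open>A strict step down before descending: only then is the resulting set below \<open>A\<close> in the
      strict sense that \<^const>\<open>lower_le_phi\<close> requires of distinct sets.\<close>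
    case False
    then obtain C where C: "C \<in> \<A>" "lower_le r C A" "?g C < ?g A"
      using mono[OF _ A] by (metis order_le_less)
    obtain B where B: "B \<in> \<A>" "lower_le r B C"
        "\<forall>A'\<in>\<A>. lower_le r A' B \<longrightarrow> ?g A' = ?g B"
      using ex[OF C(1)] by blast
    have "lower_le_phi r \<phi> B A"
      using lower_le_trans[OF tr B(2) C(2)] mono[OF B(1) C(1) B(2)] C(3)
      unfolding lower_le_phi_def by (metis le_less_trans)
    with B(1,3) show ?thesis by blast
  qed
  then obtain B where B: "B \<in> \<A>" "lower_le_phi r \<phi> B A"
      "\<forall>A'\<in>\<A>. lower_le r A' B \<longrightarrow> ?g A' = ?g B"
    by blast
  \<comment> \<open>A different set below \<open>B\<close> would have a strictly smaller infimum,
    against the constancy of the infimum below \<open>B\<close>.\<close>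
  then have "minimal_in (lower_le_phi r \<phi>) \<A> B"
    unfolding minimal_in_def lower_le_phi_def by fastforce
  with B show "\<exists>Abar\<in>\<A>. minimal_in (lower_le_phi r \<phi>) \<A> Abar \<and> lower_le_phi r \<phi> Abar A \<and>
      (\<forall>A'\<in>\<A>. lower_le r A' Abar \<longrightarrow> Inf (\<phi> ` A') = Inf (\<phi> ` Abar))"
    by blast
qed

end
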